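(* Let $c\neq 0$ be a real constant, and consider the perturbed Benjamin-Bona-Mahony ODE $$y''=\frac{c-1}{c}\,y-\frac{3}{4c}\,\epsilon\,(y^2-1)$$ for $y=y(z)$ with small parameter $\epsilon$. Then $\mu=(1+\epsilon)y'$ is an approximate integrating factor of this ODE, and it yields the approximate first integral $$D\left(y'^2+\frac{1-c}{c}y^2+\epsilon\left(y'^2+\frac{1-c}{c}y^2-\frac{3y}{2c}+\frac{y^3}{2c}\right)\right)=O(\epsilon^2)$$ on solutions of the ODE, where $D=d/dz$ is the total derivative.
   Context: For a second-order perturbed ODE $y''=f_0(x,y,y')+\epsilon f_1(x,y,y')$ with independent variable $x$ (here $x$ is $z$), a function $\mu=\mu_0(x,y,y')+\epsilon\mu_1(x,y,y')$ is an approximate integrating factor if its components satisfy identically in $(x,y,y')$ (subscripts denote partial derivatives): $$y'\mu_{0,yy'}+\mu_{0,xy'}+2\mu_{0,y}+(\mu_0f_0)_{y'y'}=0,$$ $$y'^2\mu_{0,yy}+2y'\mu_{0,xy}+\mu_{0,xx}+y'(\mu_0f_0)_{yy'}+(\mu_0f_0)_{xy'}-(\mu_0f_0)_y=0,$$ $$y'\mu_{1,yy'}+\mu_{1,xy'}+2\mu_{1,y}+(\mu_1f_0)_{y'y'}+(\mu_0f_1)_{y'y'}=0,$$ $$y'^2\mu_{1,yy}+2y'\mu_{1,xy}+\mu_{1,xx}+y'(\mu_1f_0)_{yy'}+(\mu_1f_0)_{xy'}-(\mu_1f_0)_y-(\mu_0f_1)_y+y'(\mu_0f_1)_{yy'}+(\mu_0f_1)_{xy'}=0.$$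 These conditions express that $\mu\,(y''-f_0-\epsilon f_1)$ is a total derivative up to $O(\epsilon^2)$. "$D(\cdot)=O(\epsilon^2)$ on solutions" means that after replacing $y''$ using the ODE, the coefficients of $\epsilon^0$ and $\epsilon^1$ vanish identically in $(y,y')$. *)

theory Defs
  imports "HOL-Analysis.Analysis" "HOL-Computational_Algebra.Polynomial"
begin

text \<open>
  Functions of \<open>(x, y, y')\<close> are curried, and the third argument, standing for \<open>y'\<close>, is written \<open>p\<close>.
  A perturbed quantity additionally takes the small parameter \<open>\<epsilon>\<close> as its first argument.
\<close>

type_synonym jet_fun = "real \<Rightarrow> real \<Rightarrow> real \<Rightarrow> real"

definition d_x :: "jet_fun \<Rightarrow> jet_fun" where
  "d_x f x y p = deriv (\<lambda>t. f t y p) x"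

definition d_y :: "jet_fun \<Rightarrow> jet_fun" where
  "d_y f x y p = deriv (\<lambda>t. f x t p) y"

definition d_p :: "jet_fun \<Rightarrow> jet_fun" where
  "d_p f x y p = deriv (\<lambda>t. f x y t) p"

text \<open>
  Since \<open>deriv\<close> is unspecified at points of non-differentiability, the notions below ask for
  enough regularity to make every partial derivative they mention meaningful.
\<close>

primrec C_class :: "nat \<Rightarrow> jet_fun \<Rightarrow> bool" where
  "C_class 0 f \<longleftrightarrow> continuous_on UNIV (\<lambda>(x, y, p). f x y p)"
| "C_class (Suc n) f \<longleftrightarrow>
     (\<forall>x y p. (\<lambda>t. f t y p) differentiable at x \<and>
              (\<lambda>t. f x t p) differentiable at y \<and>
              (\<lambda>t. f x y t) differentiable at p) \<and>
     C_class n (d_x f) \<and> C_class n (d_y f) \<and> C_class n (d_p f)"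

definition jet_mult :: "jet_fun \<Rightarrow> jet_fun \<Rightarrow> jet_fun"  (infixl "\<odot>" 70) where
  "(f \<odot> g) x y p = f x y p * g x y p"

definition has_components :: "(real \<Rightarrow> jet_fun) \<Rightarrow> jet_fun \<Rightarrow> jet_fun \<Rightarrow> bool" where
  "has_components F F0 F1 \<longleftrightarrow> (\<forall>\<epsilon> x y p. F \<epsilon> x y p = F0 x y p + \<epsilon> * F1 x y p)"

text \<open>The components of \<open>F\<close> and \<open>\<mu>\<close> are unique, so the existential quantifier only names them.\<close>

definition approx_integrating_factor :: "(real \<Rightarrow> jet_fun) \<Rightarrow> (real \<Rightarrow> jet_fun) \<Rightarrow> bool" where
  "approx_integrating_factor F \<mu> \<longleftrightarrow>
    (\<exists>f0 f1 \<mu>0 \<mu>1.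
      has_components F f0 f1 \<and> has_components \<mu> \<mu>0 \<mu>1 \<and>
      C_class 2 f0 \<and> C_class 2 f1 \<and> C_class 2 \<mu>0 \<and> C_class 2 \<mu>1 \<and>
      (\<forall>x y p.
        p * d_p (d_y \<mu>0) x y p + d_p (d_x \<mu>0) x y p + 2 * d_y \<mu>0 x y p
          + d_p (d_p (\<mu>0 \<odot> f0)) x y p = 0 \<and>
        p\<^sup>2 * d_y (d_y \<mu>0) x y p + 2 * p * d_y (d_x \<mu>0) x y p + d_x (d_x \<mu>0) x y p
          + p * d_p (d_y (\<mu>0 \<odot> f0)) x y p + d_p (d_x (\<mu>0 \<odot> f0)) x y p
          - d_y (\<mu>0 \<odot> f0) x y p = 0 \<and>
        p * d_p (d_y \<mu>1) x y p + d_p (d_x \<mu>1) x y p + 2 * d_y \<mu>1 x y p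
          + d_p (d_p (\<mu>1 \<odot> f0)) x y p + d_p (d_p (\<mu>0 \<odot> f1)) x y p = 0 \<and>
        p\<^sup>2 * d_y (d_y \<mu>1) x y p + 2 * p * d_y (d_x \<mu>1) x y p + d_x (d_x \<mu>1) x y p
          + p * d_p (d_y (\<mu>1 \<odot> f0)) x y p + d_p (d_x (\<mu>1 \<odot> f0)) x y p
          - d_y (\<mu>1 \<odot> f0) x y p - d_y (\<mu>0 \<odot> f1) x y p
          + p * d_p (d_y (\<mu>0 \<odot> f1)) x y p + d_p (d_x (\<mu>0 \<odot> f1)) x y p = 0))"

text \<open>The last argument \<open>q\<close> stands for \<open>y''\<close>.\<close>

definition total_deriv :: "jet_fun \<Rightarrow> real \<Rightarrow> real \<Rightarrow> real \<Rightarrow> real \<Rightarrow> real" where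
  "total_deriv \<phi> x y p q = d_x \<phi> x y p + p * d_y \<phi> x y p + q * d_p \<phi> x y p"

text \<open>An expression in \<open>\<epsilon>\<close> is \<open>O(\<epsilon>\<^sup>2)\<close> when its coefficients of \<open>\<epsilon>\<^sup>0\<close> and \<open>\<epsilon>\<^sup>1\<close> vanish.\<close>

definition O_eps2 :: "(real \<Rightarrow> real) \<Rightarrow> bool" where
  "O_eps2 E \<longleftrightarrow> (\<exists>P. (\<forall>\<epsilon>. E \<epsilon> = poly P \<epsilon>) \<and> coeff P 0 = 0 \<and> coeff P 1 = 0)"

text \<open>\<open>D(\<Phi>) = O(\<epsilon>\<^sup>2)\<close> on solutions of \<open>y'' = F\<close>.\<close>

definition approx_first_integral :: "(real \<Rightarrow> jet_fun) \<Rightarrow> (real \<Rightarrow> jet_fun) \<Rightarrow> bool" where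
  "approx_first_integral F \<Phi> \<longleftrightarrow>
    (\<forall>\<epsilon>. C_class 1 (\<Phi> \<epsilon>)) \<and>
    (\<forall>x y p. O_eps2 (\<lambda>\<epsilon>. total_deriv (\<Phi> \<epsilon>) x y p (F \<epsilon> x y p)))"

text \<open>
  \<open>\<mu>\<close> yields \<open>\<Phi>\<close>: off solutions, \<open>\<mu> (y'' - F)\<close> is the total derivative of \<open>\<Phi>\<close> up to \<open>O(\<epsilon>\<^sup>2)\<close>.
  First integrals are only normalised up to a nonzero constant factor \<open>k\<close>; for instance the
  factor \<open>y'\<close> of \<open>y'' = 0\<close> yields \<open>y'\<^sup>2\<close> with \<open>k = 2\<close>.
\<close>

definition yields_first_integral ::
    "(real \<Rightarrow> jet_fun) \<Rightarrow> (real \<Rightarrow> jet_fun) \<Rightarrow> (real \<Rightarrow> jet_fun) \<Rightarrow> bool" where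
  "yields_first_integral F \<mu> \<Phi> \<longleftrightarrow>
    (\<forall>\<epsilon>. C_class 1 (\<Phi> \<epsilon>)) \<and>
    (\<exists>k. k \<noteq> 0 \<and>
      (\<forall>x y p q. O_eps2 (\<lambda>\<epsilon>. total_deriv (\<Phi> \<epsilon>) x y p q - k * (\<mu> \<epsilon> x y p * (q - F \<epsilon> x y p)))))"

definition bbm_rhs :: "real \<Rightarrow> real \<Rightarrow> jet_fun" where
  "bbm_rhs c \<epsilon> z y p = (c - 1) / c * y - 3 / (4 * c) * \<epsilon> * (y\<^sup>2 - 1)"

definition bbm_multiplier :: "real \<Rightarrow> jet_fun" where
  "bbm_multiplier \<epsilon> z y p = (1 + \<epsilon>) * p"

definition bbm_integral :: "real \<Rightarrow> real \<Rightarrow> jet_fun" where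
  "bbm_integral c \<epsilon> z y p =
     p\<^sup>2 + (1 - c) / c * y\<^sup>2
     + \<epsilon> * (p\<^sup>2 + (1 - c) / c * y\<^sup>2 - 3 * y / (2 * c) + y ^ 3 / (2 * c))"

end

theory Submission imports Defs begin

text \<open>
  The right-hand side depends on \<open>y\<close> alone, so the equation is that of a particle in a conservative
  force field \<open>g y\<close>, and both components of the multiplier are the velocity \<open>p\<close>. Multiplying
  \<open>y'' = g y\<close> by \<open>y'\<close> always gives a total derivative, namely that of the energy
  \<open>p\<^sup>2 / 2 - \<integral> g\<close>. In terms of the determining equations: the mixed derivative of \<open>p * g y\<close> is
  \<open>g' y\<close>, so \<open>p\<close> times it cancels the \<open>y\<close>-derivative \<open>p * g' y\<close>, and every other term vanishes
  because \<open>p * g y\<close> is affine in \<open>p\<close> and free of \<open>x\<close>.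

  The given first integral is twice \<open>1 + \<epsilon>\<close> times the energy, truncated after the first order in
  \<open>\<epsilon>\<close>. Hence its total derivative differs from \<open>2 \<mu> (y'' - F)\<close> by the truncated term only, which is
  an exact multiple of \<open>\<epsilon>\<^sup>2\<close> that does not involve \<open>y''\<close> (\<open>bbm_balance\<close>). The same identity thus
  serves off solutions, with \<open>y''\<close> free, and on solutions, where \<open>y'' = F\<close> itself depends on \<open>\<epsilon>\<close>.
\<close>

text \<open>
  Closure of \<open>C_class n\<close> under products would require continuity of the factors themselves,
  which \<open>C_class (Suc n)\<close> provides only through a mean value argument. Polynomial functions
  form a class that is closed under the partial derivatives, which makes the smoothness immediate.
\<close>

inductive polynomial_jet :: "jet_fun \<Rightarrow> bool" where
  const: "polynomial_jet (\<lambda>x y p. a)"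
| x: "polynomial_jet (\<lambda>x y p. x)"
| y: "polynomial_jet (\<lambda>x y p. y)"
| p: "polynomial_jet (\<lambda>x y p. p)"
| add: "polynomial_jet f \<Longrightarrow> polynomial_jet g \<Longrightarrow> polynomial_jet (\<lambda>x y p. f x y p + g x y p)"
| mult: "polynomial_jet f \<Longrightarrow> polynomial_jet g \<Longrightarrow> polynomial_jet (\<lambda>x y p. f x y p * g x y p)"

lemma polynomial_jet_diff:
  assumes "polynomial_jet f" "polynomial_jet g"
  shows "polynomial_jet (\<lambda>x y p. f x y p - g x y p)"
  using polynomial_jet.add[OF assms(1) polynomial_jet.mult[OF polynomial_jet.const[of "-1"] assms(2)]]
  by simp

lemma polynomial_jet_power:
  assumes "polynomial_jet f"
  shows "polynomial_jet (\<lambda>x y p. f x y p ^ n)"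
  by (induction n) (auto intro: polynomial_jet.intros assms)

lemma polynomial_jet_divide:
  assumes "polynomial_jet f"
  shows "polynomial_jet (\<lambda>x y p. f x y p / a)"
  using polynomial_jet.mult[OF assms polynomial_jet.const[of "1 / a"]] by simp

lemmas polynomial_jet_intros =
  polynomial_jet.intros polynomial_jet_diff polynomial_jet_power polynomial_jet_divide

lemma polynomial_jet_continuous:
  "polynomial_jet f \<Longrightarrow> continuous_on UNIV (\<lambda>(x, y, p). f x y p)"
  by (induction rule: polynomial_jet.induct)
     (auto simp: case_prod_unfold intro!: continuous_intros)

lemma polynomial_jet_differentiable:
  assumes "polynomial_jet f"
  shows "(\<lambda>t. f t y p) differentiable at x"
    and "(\<lambda>t. f x t p) differentiable at y"
    and "(\<lambda>t. f x y t) differentiable at p"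
  using assms by (induction rule: polynomial_jet.induct) auto

lemma polynomial_jet_field_differentiable:
  assumes "polynomial_jet f"
  shows "(\<lambda>t. f t y p) field_differentiable at x"
    and "(\<lambda>t. f x t p) field_differentiable at y"
    and "(\<lambda>t. f x y t) field_differentiable at p"
  using polynomial_jet_differentiable[OF assms]
  by (auto simp: real_differentiable_def field_differentiable_def)

lemma polynomial_jet_partials:
  assumes "polynomial_jet f"
  shows "polynomial_jet (d_x f) \<and> polynomial_jet (d_y f) \<and> polynomial_jet (d_p f)"
  using assms
proof (induction rule: polynomial_jet.induct)
  case (add f g)
  note fd = add.hyps[THEN polynomial_jet_field_differentiable(1)]
    add.hyps[THEN polynomial_jet_field_differentiable(2)]
    add.hyps[THEN polynomial_jet_field_differentiable(3)]
  have "d_x (\<lambda>x y p. f x y p + g x y p) = (\<lambda>x y p. d_x f x y p + d_x g x y p)"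
    "d_y (\<lambda>x y p. f x y p + g x y p) = (\<lambda>x y p. d_y f x y p + d_y g x y p)"
    "d_p (\<lambda>x y p. f x y p + g x y p) = (\<lambda>x y p. d_p f x y p + d_p g x y p)"
    by (auto simp: fun_eq_iff d_x_def d_y_def d_p_def fd)
  with add.IH show ?case by (auto intro: polynomial_jet.intros)
next
  case (mult f g)
  note fd = mult.hyps[THEN polynomial_jet_field_differentiable(1)]
    mult.hyps[THEN polynomial_jet_field_differentiable(2)]
    mult.hyps[THEN polynomial_jet_field_differentiable(3)]
  have "d_x (\<lambda>x y p. f x y p * g x y p) = (\<lambda>x y p. f x y p * d_x g x y p + d_x f x y p * g x y p)"
    "d_y (\<lambda>x y p. f x y p * g x y p) = (\<lambda>x y p. f x y p * d_y g x y p + d_y f x y p * g x y p)"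
    "d_p (\<lambda>x y p. f x y p * g x y p) = (\<lambda>x y p. f x y p * d_p g x y p + d_p f x y p * g x y p)"
    by (auto simp: fun_eq_iff d_x_def d_y_def d_p_def fd)
  with mult show ?case by (auto intro: polynomial_jet.intros)
qed (auto simp: d_x_def[abs_def] d_y_def[abs_def] d_p_def[abs_def] intro: polynomial_jet.intros)

lemma polynomial_jet_C_class: "polynomial_jet f \<Longrightarrow> C_class n f"
  by (induction n arbitrary: f)
     (auto simp: polynomial_jet_continuous polynomial_jet_differentiable polynomial_jet_partials)

lemma partials_velocity_mult:
  assumes "\<And>y. (g has_real_derivative g' y) (at y)"
  shows "d_x (\<lambda>x y p. p * g y) = (\<lambda>x y p. 0)"
    and "d_y (\<lambda>x y p. p * g y) = (\<lambda>x y p. p * g' y)"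
    and "d_p (\<lambda>x y p. p * g y) = (\<lambda>x y p. g y)"
  using assms
  by (auto simp: fun_eq_iff d_x_def d_y_def d_p_def
      intro!: DERIV_imp_deriv derivative_eq_intros)

lemma partials_velocity:
  "d_x (\<lambda>x y p. p) = (\<lambda>x y p. 0)" "d_y (\<lambda>x y p. p) = (\<lambda>x y p. 0)"
  by (auto simp: fun_eq_iff d_x_def d_y_def)

lemma partials_zero:
  "d_x (\<lambda>x y p. 0) = (\<lambda>x y p. 0)" "d_y (\<lambda>x y p. 0) = (\<lambda>x y p. 0)"
  "d_p (\<lambda>x y p. 0) = (\<lambda>x y p. 0)"
  by (auto simp: fun_eq_iff d_x_def d_y_def d_p_def)

text \<open>
  Each determining equation is linear in the force, so two conservative forces \<open>g\<close> and \<open>h\<close>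
  contribute independently, and each contribution vanishes by the cancellation of
  \<open>p * g' y\<close> against itself.
\<close>

lemma approx_integrating_factor_velocity:
  assumes F: "\<And>\<epsilon> x y p. F \<epsilon> x y p = g y + \<epsilon> * h y"
    and g: "\<And>y. (g has_real_derivative g' y) (at y)"
    and h: "\<And>y. (h has_real_derivative h' y) (at y)"
    and smooth: "C_class 2 (\<lambda>x y p. g y)" "C_class 2 (\<lambda>x y p. h y)"
  shows "approx_integrating_factor F (\<lambda>\<epsilon> x y p. (1 + \<epsilon>) * p)"
proof -
  have prod: "(\<lambda>x y p. p) \<odot> (\<lambda>x y p. k y) = (\<lambda>x y p. p * k y)" for k :: "real \<Rightarrow> real"
    by (simp add: fun_eq_iff jet_mult_def)
  have d_p_free: "d_p (\<lambda>x y p. k y) = (\<lambda>x y p. 0)" for k :: "real \<Rightarrow> real"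
    by (simp add: fun_eq_iff d_p_def)
  have d_p_linear: "d_p (\<lambda>x y p. p * k y) = (\<lambda>x y p. k y)" for k :: "real \<Rightarrow> real"
    by (auto simp: fun_eq_iff d_p_def)
  have "C_class 2 (\<lambda>x y p. p)"
    by (intro polynomial_jet_C_class polynomial_jet.intros)
  moreover have "has_components F (\<lambda>x y p. g y) (\<lambda>x y p. h y)"
    by (simp add: has_components_def F)
  moreover have "has_components (\<lambda>\<epsilon> x y p. (1 + \<epsilon>) * p) (\<lambda>x y p. p) (\<lambda>x y p. p)"
    by (simp add: has_components_def algebra_simps)
  ultimately show ?thesis
    unfolding approx_integrating_factor_def
    by (intro exI[of _ "\<lambda>x y p. g y"] exI[of _ "\<lambda>x y p. h y"] exI[of _ "\<lambda>x y p. p"])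
       (simp add: smooth prod partials_velocity_mult[OF g] partials_velocity_mult[OF h]
         partials_velocity partials_zero d_p_free d_p_linear)
qed

text \<open>
  The right-hand side is \<open>2 * p * f1 * \<epsilon>\<^sup>2\<close>, where \<open>f1\<close> is the coefficient of \<open>\<epsilon>\<close> in the force:
  the second-order term of \<open>2 \<mu> F\<close>, for which the truncated energy has no counterpart.
\<close>

lemma bbm_balance:
  assumes "c \<noteq> 0"
  shows "total_deriv (bbm_integral c \<epsilon>) x y p q
           - 2 * (bbm_multiplier \<epsilon> x y p * (q - bbm_rhs c \<epsilon> x y p))
         = - 3 / (2 * c) * p * (y\<^sup>2 - 1) * \<epsilon>\<^sup>2"
proof -
  have "d_x (bbm_integral c \<epsilon>) x y p = 0"
    by (simp add: d_x_def bbm_integral_def)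
  moreover have "d_p (bbm_integral c \<epsilon>) x y p = 2 * (1 + \<epsilon>) * p"
    unfolding d_p_def bbm_integral_def
    by (rule DERIV_imp_deriv) (auto intro!: derivative_eq_intros simp: algebra_simps)
  moreover have "d_y (bbm_integral c \<epsilon>) x y p
      = 2 * (1 + \<epsilon>) * ((1 - c) / c) * y + \<epsilon> * (3 / (2 * c)) * (y\<^sup>2 - 1)"
    unfolding d_y_def bbm_integral_def
    by (rule DERIV_imp_deriv)
       (use assms in \<open>auto intro!: derivative_eq_intros simp: field_simps power2_eq_square\<close>)
  ultimately show ?thesis
    unfolding total_deriv_def bbm_multiplier_def bbm_rhs_def
    by (simp only:) (use assms in \<open>simp add: field_simps power2_eq_square\<close>)
qed

lemma O_eps2_monomial: "O_eps2 (\<lambda>\<epsilon>. a * \<epsilon>\<^sup>2)"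
  unfolding O_eps2_def by (intro exI[of _ "monom a 2"]) (simp add: poly_monom)

theorem mainTheorem4:
  fixes c :: real
  assumes "c \<noteq> 0"
  shows "approx_integrating_factor (bbm_rhs c) bbm_multiplier
    \<and> yields_first_integral (bbm_rhs c) bbm_multiplier (bbm_integral c)
    \<and> approx_first_integral (bbm_rhs c) (bbm_integral c)"
proof (intro conjI)
  have "approx_integrating_factor (bbm_rhs c) (\<lambda>\<epsilon> x y p. (1 + \<epsilon>) * p)"
  proof (rule approx_integrating_factor_velocity)
    show "bbm_rhs c \<epsilon> x y p = (c - 1) / c * y + \<epsilon> * (- 3 / (4 * c) * (y\<^sup>2 - 1))" for \<epsilon> x y p
      by (simp add: bbm_rhs_def)
    show "((\<lambda>y. (c - 1) / c * y) has_real_derivative (c - 1) / c) (at y)" for y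
      by (rule DERIV_cmult_Id)
    show "((\<lambda>y. - 3 / (4 * c) * (y\<^sup>2 - 1)) has_real_derivative - 3 / (4 * c) * (2 * y)) (at y)" for y
      by (rule DERIV_cmult) (auto intro!: derivative_eq_intros)
    show "C_class 2 (\<lambda>x y p. (c - 1) / c * y)" "C_class 2 (\<lambda>x y p. - 3 / (4 * c) * (y\<^sup>2 - 1))"
      by (intro polynomial_jet_C_class polynomial_jet_intros)+
  qed
  then show "approx_integrating_factor (bbm_rhs c) bbm_multiplier"
    by (simp add: bbm_multiplier_def[abs_def])
  have smooth: "C_class 1 (bbm_integral c \<epsilon>)" for \<epsilon>
    unfolding bbm_integral_def[abs_def] by (intro polynomial_jet_C_class polynomial_jet_intros)
  \<comment> \<open>The energy carries \<open>p\<^sup>2\<close> instead of \<open>p\<^sup>2 / 2\<close>, hence the constant factor 2.\<close>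
  show "yields_first_integral (bbm_rhs c) bbm_multiplier (bbm_integral c)"
    unfolding yields_first_integral_def
    by (intro conjI exI[of _ 2] allI smooth) (simp, simp only: bbm_balance[OF assms] O_eps2_monomial)
  have "total_deriv (bbm_integral c \<epsilon>) x y p (bbm_rhs c \<epsilon> x y p)
      = - 3 / (2 * c) * p * (y\<^sup>2 - 1) * \<epsilon>\<^sup>2" for \<epsilon> x y p
    using bbm_balance[OF assms, of \<epsilon> x y p "bbm_rhs c \<epsilon> x y p"] by simp
  then show "approx_first_integral (bbm_rhs c) (bbm_integral c)"
    unfolding approx_first_integral_def by (simp only: smooth O_eps2_monomial) simp
qed

end
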